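(* Let $L$ be the ring of integer (Lipschitz) quaternions, let $A$ be a $\mathrm{central}^*$ set in $(L,+)$ and let $\langle y_n\rangle_{n=1}^\infty$ be a minimal sequence in $(L,+)$. Then there exists a sum subsystem $\langle x_n\rangle_{n=1}^\infty$ of $\langle y_n\rangle_{n=1}^\infty$ such that $FS(\langle x_n\rangle_{n=1}^\infty)\cup AP(\langle x_n\rangle_{n=1}^\infty)\subseteq A$.
   Context: $L=\{a+bi+cj+dk:a,b,c,d\in\mathbb{Z}\}$ with $i^2=j^2=k^2=ijk=-1$. $FS(\langle x_n\rangle_{n=m}^\infty)=\{\sum_{n\in F}x_n: F$ a finite nonempty subset of $\{m,m+1,\dots\}\}$. $AP(\langle x_n\rangle_{n=1}^\infty)$ is the set of all products $x_{\sigma(1)}\cdots x_{\sigma(r)}$ with $r\ge1$ and $\sigma:\{1,\dots,r\}\to\mathbb{N}$ injective (finite products of terms in any order, no repetitions). A sequence $\langle x_n\rangle$ is a sum subsystem of $\langle y_n\rangle$ if there are finite nonempty $H_n\subseteq\mathbb{N}$ with $\max H_n<\min H_{n+1}$ and $x_n=\sum_{t\in H_n}y_t$. $\beta L$ is the set of ultrafilters on $L$ with $A\in p+q$ iff $\{x:-x+A\in q\}\in p$ ($-x+A=\{y:x+y\in A\}$), a compact right topological semigroup with smallest ideal $K(\beta L)$; $\overline{B}=\{p:B\in p\}$. A set is $\mathrm{central}^*$ if it belongs to every idempotent of $K(\beta L)$. A sequence $\langle y_n\rangle$ is minimal if $\bigcap_{m=1}^\infty\overline{FS(\langle y_n\rangle_{n=m}^\infty)}\cap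 K(\beta L)\neq\emptyset$. *)

theory Defs
  imports Main
begin

subsection \<open>Lipschitz quaternions\<close>

text \<open>\<open>Lipschitz a b c d\<close> stands for $a + bi + cj + dk$.\<close>

datatype lipschitz = Lipschitz (coeff1: int) (coeffi: int) (coeffj: int) (coeffk: int)

instantiation lipschitz :: ring_1
begin

definition "0 = Lipschitz 0 0 0 0"

definition "1 = Lipschitz 1 0 0 0"

definition "- x = Lipschitz (- coeff1 x) (- coeffi x) (- coeffj x) (- coeffk x)"

definition "x + y = Lipschitz (coeff1 x + coeff1 y) (coeffi x + coeffi y) (coeffj x + coeffj y) (coeffk x + coeffk y)"

definition "x - y = Lipschitz (coeff1 x - coeff1 y) (coeffi x - coeffi y) (coeffj x - coeffj y) (coeffk x - coeffk y)"

definition "x * y = Lipschitz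
  (coeff1 x * coeff1 y - coeffi x * coeffi y - coeffj x * coeffj y - coeffk x * coeffk y)
  (coeff1 x * coeffi y + coeffi x * coeff1 y + coeffj x * coeffk y - coeffk x * coeffj y)
  (coeff1 x * coeffj y - coeffi x * coeffk y + coeffj x * coeff1 y + coeffk x * coeffi y)
  (coeff1 x * coeffk y + coeffi x * coeffj y - coeffj x * coeffi y + coeffk x * coeff1 y)"

instance
  by standard
    (simp_all add: zero_lipschitz_def one_lipschitz_def uminus_lipschitz_def plus_lipschitz_def
      minus_lipschitz_def times_lipschitz_def algebra_simps)

end

lemma
  defines "i \<equiv> Lipschitz 0 1 0 0" and "j \<equiv> Lipschitz 0 0 1 0" and "k \<equiv> Lipschitz 0 0 0 1"
  shows lipschitz_i_squared: "i * i = -1" and lipschitz_j_squared: "j * j = -1"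
    and lipschitz_k_squared: "k * k = -1" and lipschitz_ijk: "i * j * k = -1"
  by (simp_all add: i_def j_def k_def one_lipschitz_def uminus_lipschitz_def times_lipschitz_def)


subsection \<open>The semigroup of ultrafilters on an additive semigroup\<close>

text \<open>
  An ultrafilter \<open>p\<close> is represented as a filter in the sense of the library, so that $A \in p$
  is expressed as \<open>\<forall>\<^sub>F x in p. x \<in> A\<close>. The library allows the improper filter \<open>bot\<close>,
  which has to be excluded.
\<close>

definition beta :: "'a filter set" where
  "beta = {p. p \<noteq> bot \<and> (\<forall>A. (\<forall>\<^sub>F x in p. x \<in> A) \<or> (\<forall>\<^sub>F x in p. x \<notin> A))}"

definition beta_closure :: "'a set \<Rightarrow> 'a filter set" where
  "beta_closure B = {p \<in> beta. \<forall>\<^sub>F x in p. x \<in> B}"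

definition beta_add :: "'a::semigroup_add filter \<Rightarrow> 'a filter \<Rightarrow> 'a filter" (infixl \<open>+\<^sub>\<beta>\<close> 65) where
  "p +\<^sub>\<beta> q = Abs_filter (\<lambda>P. \<forall>\<^sub>F x in p. \<forall>\<^sub>F y in q. P (x + y))"

lemma eventually_beta_add:
  "(\<forall>\<^sub>F z in p +\<^sub>\<beta> q. P z) \<longleftrightarrow> (\<forall>\<^sub>F x in p. \<forall>\<^sub>F y in q. P (x + y))"
  unfolding beta_add_def
proof (rule eventually_Abs_filter, rule is_filter.intro)
  show "\<forall>\<^sub>F x in p. \<forall>\<^sub>F y in q. True"
    by simp
next
  fix P Q :: "'a \<Rightarrow> bool"
  assume "\<forall>\<^sub>F x in p. \<forall>\<^sub>F y in q. P (x + y)" "\<forall>\<^sub>F x in p. \<forall>\<^sub>F y in q. Q (x + y)"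
  then show "\<forall>\<^sub>F x in p. \<forall>\<^sub>F y in q. P (x + y) \<and> Q (x + y)"
    by (simp add: eventually_conj_iff)
next
  fix P Q :: "'a \<Rightarrow> bool"
  assume "\<forall>x. P x \<longrightarrow> Q x" "\<forall>\<^sub>F x in p. \<forall>\<^sub>F y in q. P (x + y)"
  then show "\<forall>\<^sub>F x in p. \<forall>\<^sub>F y in q. Q (x + y)"
    by (auto elim!: eventually_mono)
qed

lemma mem_beta_add:
  "(\<forall>\<^sub>F z in p +\<^sub>\<beta> q. z \<in> A) \<longleftrightarrow> (\<forall>\<^sub>F x in p. x \<in> {x. \<forall>\<^sub>F y in q. y \<in> {y. x + y \<in> A}})"
  by (simp add: eventually_beta_add)

definition beta_ideal :: "'a::semigroup_add filter set \<Rightarrow> bool" where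
  "beta_ideal I \<longleftrightarrow> I \<noteq> {} \<and> I \<subseteq> beta \<and> (\<forall>p\<in>beta. \<forall>q\<in>I. p +\<^sub>\<beta> q \<in> I \<and> q +\<^sub>\<beta> p \<in> I)"

text \<open>
  A smallest ideal exists, because the ultrafilters form a compact right topological semigroup;
  it is then the intersection of all ideals.
\<close>

definition beta_K :: "'a::semigroup_add filter set" where
  "beta_K = \<Inter>{I. beta_ideal I}"

definition central_star :: "'a::semigroup_add set \<Rightarrow> bool" where
  "central_star A \<longleftrightarrow> (\<forall>p\<in>beta_K. p +\<^sub>\<beta> p = p \<longrightarrow> (\<forall>\<^sub>F x in p. x \<in> A))"


subsection \<open>Finite sums and finite products\<close>

text \<open>
  Sequences $\langle x_n\rangle_{n=1}^\infty$ are functions on \<open>nat\<close> whose value at \<open>0\<close> is never used.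
\<close>

definition FS :: "(nat \<Rightarrow> 'a::comm_monoid_add) \<Rightarrow> nat \<Rightarrow> 'a set" where
  "FS x m = {\<Sum>n\<in>F. x n | F. finite F \<and> F \<noteq> {} \<and> F \<subseteq> {m..}}"

text \<open>The injective map $\sigma$ is given as the list of its values, without repetitions.\<close>

definition AP :: "(nat \<Rightarrow> 'a::monoid_mult) \<Rightarrow> 'a set" where
  "AP x = {prod_list (map x ns) | ns. ns \<noteq> [] \<and> distinct ns \<and> set ns \<subseteq> {1..}}"

definition sum_subsystem :: "(nat \<Rightarrow> 'a::comm_monoid_add) \<Rightarrow> (nat \<Rightarrow> 'a) \<Rightarrow> bool" where
  "sum_subsystem x y \<longleftrightarrow> (\<exists>H :: nat \<Rightarrow> nat set. \<forall>n\<ge>1.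
     finite (H n) \<and> H n \<noteq> {} \<and> H n \<subseteq> {1..} \<and> Max (H n) < Min (H (Suc n)) \<and>
     x n = (\<Sum>t\<in>H n. y t))"

definition minimal_seq :: "(nat \<Rightarrow> 'a::comm_monoid_add) \<Rightarrow> bool" where
  "minimal_seq y \<longleftrightarrow> (\<Inter>m\<in>{1..}. beta_closure (FS y m)) \<inter> beta_K \<noteq> {}"

end

theory Submission
  imports Defs
begin

text \<open>
  Let \<open>q\<close> lie in the smallest ideal \<open>K\<close> and in \<open>T\<close>, the intersection of the closures of the sets
  \<open>FS y m\<close>. Then \<open>T + q\<close> is a compact semigroup inside \<open>T \<inter> K\<close>, so it contains an
  idempotent \<open>p\<close>, which has \<open>A\<close> as a member. For nonzero quaternions \<open>a\<close>, \<open>b\<close> the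
  endomorphism \<open>h x = a * x * b\<close> of \<open>(L,+)\<close> has an image of finite index, so every ideal of
  \<open>\<beta>L\<close> meets the image of \<open>\<beta>L\<close> under \<open>h\<close>; hence the preimage of an ideal under \<open>h\<close> is again an
  ideal, and \<open>h\<close> maps \<open>K\<close> into \<open>K\<close>. So \<open>h p\<close> is also an idempotent of \<open>K\<close>, and \<open>{x. a * x * b \<in> A}\<close>
  is a member of \<open>p\<close>. The sequence is now built recursively: each new term is taken from the
  intersection of finitely many members of \<open>p\<close>.

  A closed subset of the space of ultrafilters is represented by the filter of its neighbourhoods, so
  that a closed subsemigroup becomes a filter \<open>F\<close> with \<open>F +\<^sub>\<beta> F \<le> F\<close>.
\<close>

section \<open>Ultrafilters\<close>

text \<open>Zorn's lemma for the reversed order. Compactness of the ultrafilter space enters here: a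
  chain is directed, so whatever holds eventually in its infimum already does so in one member, and
  the infimum of proper filters stays proper.\<close>

lemma exists_minimal_filter:
  fixes F0 :: "'a filter"
  assumes "P F0" "F0 \<noteq> bot"
    and chain: "\<And>C. C \<noteq> {} \<Longrightarrow> (\<And>F G. F \<in> C \<Longrightarrow> G \<in> C \<Longrightarrow> F \<le> G \<or> G \<le> F) \<Longrightarrow>
      (\<And>F. F \<in> C \<Longrightarrow> P F) \<Longrightarrow> P (Inf C)"
  shows "\<exists>F\<le>F0. F \<noteq> bot \<and> P F \<and> (\<forall>G\<le>F. G \<noteq> bot \<longrightarrow> P G \<longrightarrow> G = F)"
proof -
  let ?A = "{F. F \<le> F0 \<and> F \<noteq> bot \<and> P F}"
  let ?R = "relation_of (\<ge>) ?A"
  have "\<exists>F\<in>?A. \<forall>G\<in>?A. F \<ge> G \<longrightarrow> G = F"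
  proof (rule predicate_Zorn)
    show "partial_order_on ?A ?R"
      by (rule partial_order_on_relation_ofI) auto
  next
    fix C assume C: "C \<in> Chains ?R"
    then have sub: "F \<le> F0" "F \<noteq> bot" "P F" if "F \<in> C" for F
      using that by (auto simp: Chains_def relation_of_def)
    have lin: "F \<le> G \<or> G \<le> F" if "F \<in> C" "G \<in> C" for F G
      using C that by (auto simp: Chains_def relation_of_def)
    show "\<exists>u\<in>?A. \<forall>F\<in>C. F \<ge> u"
    proof (cases "C = {}")
      case True
      then show ?thesis using assms by auto
    next
      case False
      have "\<exists>H\<in>C. H \<le> inf F G" if "F \<in> C" "G \<in> C" for F G
        using lin[OF that] that by auto
      then have ev: "eventually Q (Inf C) \<longleftrightarrow> (\<exists>F\<in>C. eventually Q F)" for Q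
        by (intro eventually_Inf_base False)
      have "Inf C \<noteq> bot"
        using ev[of "\<lambda>_. False"] sub(2) by (auto simp: trivial_limit_def)
      moreover have "P (Inf C)"
        using chain False lin sub(3) by blast
      moreover obtain F where "F \<in> C"
        using False by blast
      then have "Inf C \<le> F0"
        using Inf_lower sub(1) order_trans by blast
      ultimately show ?thesis
        by (auto intro: Inf_lower)
    qed
  qed
  then show ?thesis
    by (metis (mono_tags, lifting) mem_Collect_eq order_trans)
qed

text \<open>A minimal proper filter decides every set: its meet with \<open>principal A\<close> is
  either \<open>bot\<close> or the filter itself.\<close>

lemma ex_beta_le:
  assumes "F \<noteq> bot"
  shows "\<exists>p\<in>beta. p \<le> F"
proof -
  obtain p where p: "p \<le> F" "p \<noteq> bot" and min: "\<And>G. G \<le> p \<Longrightarrow> G \<noteq> bot \<Longrightarrow> G = p"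
    using exists_minimal_filter[of "\<lambda>_. True" F] assms by auto
  have "(\<forall>\<^sub>F x in p. x \<in> A) \<or> (\<forall>\<^sub>F x in p. x \<notin> A)" for A
  proof (rule disjCI)
    assume "\<not> (\<forall>\<^sub>F x in p. x \<notin> A)"
    then have "inf p (principal A) \<noteq> bot"
      by (simp add: trivial_limit_def eventually_inf_principal)
    then have "inf p (principal A) = p"
      by (intro min) auto
    then have "p \<le> principal A"
      by (metis inf.cobounded2)
    then show "\<forall>\<^sub>F x in p. x \<in> A"
      by (simp add: le_principal)
  qed
  then show ?thesis
    using p by (auto simp: beta_def)
qed

lemma beta_not_bot: "p \<in> beta \<Longrightarrow> p \<noteq> bot"
  by (simp add: beta_def)

lemma beta_not_eventually:
  assumes "p \<in> beta"
  shows "\<not> eventually P p \<longleftrightarrow> (\<forall>\<^sub>F x in p. \<not> P x)"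
proof
  assume "\<not> eventually P p"
  then show "\<forall>\<^sub>F x in p. \<not> P x"
    using assms unfolding beta_def by (auto dest: spec[of _ "{x. P x}"])
next
  assume "\<forall>\<^sub>F x in p. \<not> P x"
  then show "\<not> eventually P p"
    using beta_not_bot[OF assms] eventually_conj[of P p "\<lambda>x. \<not> P x"] by (simp add: trivial_limit_def) blast
qed

lemma betaI:
  assumes "\<And>P. \<not> eventually P p \<longleftrightarrow> (\<forall>\<^sub>F x in p. \<not> P x)"
  shows "p \<in> beta"
proof -
  have "\<not> (\<forall>\<^sub>F x in p. False)"
    using assms[of "\<lambda>_. True"] by simp
  moreover have "(\<forall>\<^sub>F x in p. x \<in> A) \<or> (\<forall>\<^sub>F x in p. x \<notin> A)" for A
    using assms[of "\<lambda>x. x \<in> A"] by blast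
  ultimately show ?thesis
    by (simp add: beta_def trivial_limit_def)
qed

text \<open>Serves to turn inequalities below an ultrafilter into equations.\<close>

lemma beta_minimal:
  assumes "p \<in> beta" "F \<noteq> bot" "F \<le> p"
  shows "F = p"
proof (rule antisym[OF assms(3)], rule filter_leI)
  fix P assume P: "eventually P F"
  show "eventually P p"
  proof (rule ccontr)
    assume "\<not> eventually P p"
    then have "\<forall>\<^sub>F x in F. \<not> P x"
      using assms beta_not_eventually filter_leD by blast
    with P have "\<forall>\<^sub>F x in F. False"
      by eventually_elim auto
    then show False
      using assms(2) by (simp add: trivial_limit_def)
  qed
qed

lemma beta_finite_partition:
  assumes "p \<in> beta" "finite G" "\<forall>\<^sub>F x in p. \<exists>g\<in>G. P g x"
  shows "\<exists>g\<in>G. \<forall>\<^sub>F x in p. P g x"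
proof (rule ccontr)
  assume "\<not> ?thesis"
  then have "\<forall>g\<in>G. \<forall>\<^sub>F x in p. \<not> P g x"
    using assms(1) beta_not_eventually by blast
  then have "\<forall>\<^sub>F x in p. \<forall>g\<in>G. \<not> P g x"
    using assms(2) by (simp add: eventually_ball_finite)
  then show False
    using beta_not_eventually[OF assms(1), of "\<lambda>x. \<exists>g\<in>G. P g x"] assms(3) by simp
qed

lemma principal_singleton_beta: "principal {x} \<in> beta"
  by (rule betaI) (simp add: eventually_principal)

lemma filtermap_beta: "p \<in> beta \<Longrightarrow> filtermap h p \<in> beta"
  by (rule betaI) (simp add: eventually_filtermap beta_not_eventually)


section \<open>Addition of filters\<close>

lemma beta_add_closed: "p \<in> beta \<Longrightarrow> q \<in> beta \<Longrightarrow> p +\<^sub>\<beta> q \<in> beta"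
  by (rule betaI) (simp add: eventually_beta_add beta_not_eventually)

lemma beta_add_assoc: "p +\<^sub>\<beta> q +\<^sub>\<beta> r = p +\<^sub>\<beta> (q +\<^sub>\<beta> r)"
  by (simp add: filter_eq_iff eventually_beta_add add.assoc)

lemma beta_add_mono: "p \<le> p' \<Longrightarrow> q \<le> q' \<Longrightarrow> p +\<^sub>\<beta> q \<le> p' +\<^sub>\<beta> q'"
  unfolding le_filter_def eventually_beta_add by (metis (mono_tags, lifting) eventually_mono)

lemma beta_add_not_bot: "p \<noteq> bot \<Longrightarrow> q \<noteq> bot \<Longrightarrow> p +\<^sub>\<beta> q \<noteq> bot"
  by (simp add: trivial_limit_def eventually_beta_add)

lemma filtermap_beta_add:
  assumes "\<And>x y. h (x + y) = h x + h y"
  shows "filtermap h (p +\<^sub>\<beta> q) = filtermap h p +\<^sub>\<beta> filtermap h q"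
  by (simp add: filter_eq_iff eventually_beta_add eventually_filtermap assms)

text \<open>The largest filter \<open>F\<close> with \<open>F +\<^sub>\<beta> q \<le> p\<close>. For
  ultrafilters it represents the closed set of solutions \<open>t\<close> of
  \<open>t +\<^sub>\<beta> q = p\<close>, the preimage of a point under the continuous right
  translation by \<open>q\<close>.\<close>

definition beta_residual :: "'a::semigroup_add filter \<Rightarrow> 'a filter \<Rightarrow> 'a filter" where
  "beta_residual p q = (INF B\<in>{B. \<forall>\<^sub>F x in p. x \<in> B}. principal {x. \<forall>\<^sub>F y in q. x + y \<in> B})"

lemma eventually_beta_residual:
  "eventually P (beta_residual p q) \<longleftrightarrow>
    (\<exists>B. (\<forall>\<^sub>F x in p. x \<in> B) \<and> (\<forall>x. (\<forall>\<^sub>F y in q. x + y \<in> B) \<longrightarrow> P x))"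
  unfolding beta_residual_def
proof (subst eventually_INF_base)
  show "{B. \<forall>\<^sub>F x in p. x \<in> B} \<noteq> {}"
    by (auto intro!: exI[of _ UNIV])
next
  fix B C assume "B \<in> {B. \<forall>\<^sub>F x in p. x \<in> B}" "C \<in> {B. \<forall>\<^sub>F x in p. x \<in> B}"
  then show "\<exists>D\<in>{B. \<forall>\<^sub>F x in p. x \<in> B}. principal {x. \<forall>\<^sub>F y in q. x + y \<in> D}
      \<le> inf (principal {x. \<forall>\<^sub>F y in q. x + y \<in> B}) (principal {x. \<forall>\<^sub>F y in q. x + y \<in> C})"
    by (intro bexI[of _ "B \<inter> C"]) (auto simp: eventually_conj_iff)
qed (auto simp: eventually_principal)

lemma le_beta_residual_iff: "F \<le> beta_residual p q \<longleftrightarrow> F +\<^sub>\<beta> q \<le> p"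
proof
  assume F: "F \<le> beta_residual p q"
  show "F +\<^sub>\<beta> q \<le> p"
  proof (rule filter_leI)
    fix P assume "eventually P p"
    then have "\<forall>\<^sub>F x in beta_residual p q. \<forall>\<^sub>F y in q. P (x + y)"
      unfolding eventually_beta_residual by (auto intro!: exI[of _ "{x. P x}"])
    then show "eventually P (F +\<^sub>\<beta> q)"
      using F by (simp add: eventually_beta_add filter_leD)
  qed
next
  assume F: "F +\<^sub>\<beta> q \<le> p"
  show "F \<le> beta_residual p q"
  proof (rule filter_leI)
    fix P assume "eventually P (beta_residual p q)"
    then obtain B where B: "\<forall>\<^sub>F x in p. x \<in> B" "\<And>x. \<forall>\<^sub>F y in q. x + y \<in> B \<Longrightarrow> P x"
      unfolding eventually_beta_residual by blast
    have "\<forall>\<^sub>F x in F. \<forall>\<^sub>F y in q. x + y \<in> B"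
      using filter_leD[OF F B(1)] by (simp add: eventually_beta_add)
    then show "eventually P F"
      by (rule eventually_mono) (rule B(2))
  qed
qed

text \<open>Otherwise some event \<open>P\<close> of \<open>F\<close> and some \<open>B\<close> in
  \<open>p\<close> are incompatible: for each \<open>x\<close> satisfying \<open>P\<close>,
  \<open>q\<close>-almost all \<open>x + y\<close> miss \<open>B\<close>, as \<open>q\<close> is an
  ultrafilter. Then the complement of \<open>B\<close> holds eventually in
  \<open>F +\<^sub>\<beta> q\<close>, hence in \<open>p\<close>.\<close>

lemma inf_beta_residual_not_bot:
  assumes "p \<in> beta" "q \<in> beta" "p \<le> F +\<^sub>\<beta> q"
  shows "inf F (beta_residual p q) \<noteq> bot"
proof
  assume "inf F (beta_residual p q) = bot"
  then obtain P B where P: "eventually P F" and B: "\<forall>\<^sub>F x in p. x \<in> B"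
    and PB: "\<And>x. P x \<Longrightarrow> \<forall>\<^sub>F y in q. x + y \<in> B \<Longrightarrow> False"
    by (auto simp: trivial_limit_def eventually_inf eventually_beta_residual)
  from P have "\<forall>\<^sub>F x in F. \<forall>\<^sub>F y in q. x + y \<notin> B"
    by (rule eventually_mono) (use PB beta_not_eventually[OF assms(2)] in blast)
  then have "\<forall>\<^sub>F x in p. x \<notin> B"
    by (intro filter_leD[OF assms(3)]) (simp add: eventually_beta_add)
  then show False
    using B beta_not_eventually[OF assms(1)] by blast
qed

text \<open>Right translation by \<open>q\<close> is a closed map.\<close>

lemma beta_le_add_right:
  assumes "p \<in> beta" "q \<in> beta" "p \<le> F +\<^sub>\<beta> q"
  shows "\<exists>t\<in>beta. t \<le> F \<and> t +\<^sub>\<beta> q = p"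
proof -
  obtain t where t: "t \<in> beta" "t \<le> inf F (beta_residual p q)"
    using inf_beta_residual_not_bot[OF assms] ex_beta_le by blast
  then have "t +\<^sub>\<beta> q \<le> p"
    by (simp flip: le_beta_residual_iff)
  then have "t +\<^sub>\<beta> q = p"
    using assms t(1) beta_minimal beta_add_not_bot beta_not_bot by blast
  with t show ?thesis by auto
qed

text \<open>By associativity, the \<open>t\<close> with \<open>t +\<^sub>\<beta> p \<le> p\<close>
  form a semigroup.\<close>

lemma beta_residual_self_add: "beta_residual p p +\<^sub>\<beta> beta_residual p p \<le> beta_residual p p"
proof -
  have *: "beta_residual p p +\<^sub>\<beta> p \<le> p"
    by (simp flip: le_beta_residual_iff)
  then have "beta_residual p p +\<^sub>\<beta> (beta_residual p p +\<^sub>\<beta> p) \<le> p"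
    using beta_add_mono order_refl order_trans by metis
  then show ?thesis
    by (simp add: le_beta_residual_iff beta_add_assoc)
qed

text \<open>Ellis' theorem: a compact subsemigroup contains an idempotent.\<close>

lemma ex_idempotent:
  fixes F0 :: "'a::semigroup_add filter"
  assumes "F0 \<noteq> bot" "F0 +\<^sub>\<beta> F0 \<le> F0"
  shows "\<exists>p\<in>beta. p \<le> F0 \<and> p +\<^sub>\<beta> p = p"
proof -
  let ?P = "\<lambda>F :: 'a filter. F +\<^sub>\<beta> F \<le> F"
  have "\<exists>F\<le>F0. F \<noteq> bot \<and> ?P F \<and> (\<forall>G\<le>F. G \<noteq> bot \<longrightarrow> ?P G \<longrightarrow> G = F)"
  proof (rule exists_minimal_filter)
    fix C :: "'a filter set"
    assume "\<And>F. F \<in> C \<Longrightarrow> ?P F"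
    then show "?P (Inf C)"
      by (meson Inf_greatest Inf_lower beta_add_mono order_trans)
  qed (use assms in auto)
  then obtain F where F: "F \<le> F0" "F \<noteq> bot" "?P F"
    and min: "\<And>G. G \<le> F \<Longrightarrow> G \<noteq> bot \<Longrightarrow> ?P G \<Longrightarrow> G = F"
    by blast
  obtain p where p: "p \<in> beta" "p \<le> F"
    using ex_beta_le F(2) by blast
  \<comment> \<open>The translate of the minimal compact semigroup by its point \<open>p\<close> is
    a compact subsemigroup, hence everything.\<close>
  have "F +\<^sub>\<beta> p = F"
  proof (rule min)
    show "F +\<^sub>\<beta> p \<le> F"
      using p(2) F(3) beta_add_mono order_refl order_trans by metis
    then have "F +\<^sub>\<beta> p +\<^sub>\<beta> (F +\<^sub>\<beta> p) \<le> F +\<^sub>\<beta> (F +\<^sub>\<beta> p)"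
      by (intro beta_add_mono order_refl)
    also have "\<dots> \<le> F +\<^sub>\<beta> p"
      using F(3) beta_add_mono[of "F +\<^sub>\<beta> F" F p p] by (simp add: beta_add_assoc)
    finally show "?P (F +\<^sub>\<beta> p)" .
  qed (use F p beta_add_not_bot beta_not_bot in blast)
  \<comment> \<open>The points of \<open>F\<close> that fix \<open>p\<close> from the left also form
    a compact subsemigroup. It is nonempty because \<open>p\<close> lies in \<open>F\<close>, which
    equals \<open>F +\<^sub>\<beta> p\<close>.\<close>
  moreover have "inf F (beta_residual p p) = F"
  proof (rule min)
    show "inf F (beta_residual p p) \<noteq> bot"
      using inf_beta_residual_not_bot p calculation by metis
    show "?P (inf F (beta_residual p p))"
      by (meson F(3) beta_add_mono beta_residual_self_add inf.cobounded1 inf.cobounded2 le_inf_iff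
          order_trans)
  qed simp
  then have "F +\<^sub>\<beta> p \<le> p"
    by (metis inf.cobounded2 le_beta_residual_iff)
  ultimately have "F = p"
    using F(2) beta_minimal p(1) by metis
  then show ?thesis
    using p F \<open>F +\<^sub>\<beta> p = F\<close> by auto
qed


section \<open>The smallest ideal\<close>

lemma beta_ideal_add:
  assumes "beta_ideal I" "p \<in> beta" "q \<in> I"
  shows "p +\<^sub>\<beta> q \<in> I" "q +\<^sub>\<beta> p \<in> I"
  using assms unfolding beta_ideal_def by blast+

lemma beta_ideal_subset: "beta_ideal I \<Longrightarrow> I \<subseteq> beta"
  unfolding beta_ideal_def by blast

lemma beta_K_subset_ideal: "beta_ideal I \<Longrightarrow> beta_K \<subseteq> I"
  unfolding beta_K_def by (rule Inter_lower) simp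

lemma beta_K_add_left:
  assumes "p \<in> beta" "q \<in> beta_K"
  shows "p +\<^sub>\<beta> q \<in> beta_K"
  unfolding beta_K_def
proof (rule InterI, drule CollectD)
  fix I :: "'a filter set" assume "beta_ideal I"
  then show "p +\<^sub>\<beta> q \<in> I"
    using assms beta_K_subset_ideal beta_ideal_add(1) by blast
qed

lemma beta_K_subset_beta: "beta_K \<subseteq> (beta :: 'a::semigroup_add filter set)"
proof -
  have "beta_ideal (beta :: 'a filter set)"
    unfolding beta_ideal_def
  proof (intro conjI ballI)
    show "beta \<noteq> ({} :: 'a filter set)"
      using principal_singleton_beta by (metis emptyE)
  qed (simp_all add: beta_add_closed)
  then show ?thesis
    by (rule beta_K_subset_ideal)
qed

lemma ex_idempotent_beta_K:
  fixes F :: "'a::semigroup_add filter"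
  assumes "F +\<^sub>\<beta> F \<le> F" "q \<in> beta_K" "q \<le> F"
  shows "\<exists>p\<in>beta_K. p \<le> F \<and> p +\<^sub>\<beta> p = p"
proof -
  have q: "q \<in> beta"
    using assms(2) beta_K_subset_beta by blast
  then have "F \<noteq> bot"
    using assms(3) beta_not_bot bot_unique by blast
  have Fq: "F +\<^sub>\<beta> q \<le> F"
    using assms beta_add_mono order_refl order_trans by metis
  have "F +\<^sub>\<beta> q +\<^sub>\<beta> (F +\<^sub>\<beta> q) \<le> F +\<^sub>\<beta> (F +\<^sub>\<beta> q)"
    using Fq by (intro beta_add_mono order_refl)
  also have "\<dots> \<le> F +\<^sub>\<beta> q"
    using assms(1) beta_add_mono[of "F +\<^sub>\<beta> F" F q q] by (simp add: beta_add_assoc)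
  finally obtain p where p: "p \<in> beta" "p \<le> F +\<^sub>\<beta> q" "p +\<^sub>\<beta> p = p"
    using ex_idempotent \<open>F \<noteq> bot\<close> q beta_add_not_bot beta_not_bot by blast
  \<comment> \<open>Every ultrafilter below \<open>F +\<^sub>\<beta> q\<close> is a translate of
    \<open>q\<close>, and \<open>beta_K\<close> absorbs translations.\<close>
  obtain t where "t \<in> beta" "t +\<^sub>\<beta> q = p"
    using beta_le_add_right[OF p(1) q p(2)] by blast
  then have "p \<in> beta_K"
    using assms(2) beta_K_add_left by blast
  then show ?thesis
    using p Fq order_trans by blast
qed

text \<open>The nonprincipal ultrafilters on an infinite group form an ideal. This later allows all
  terms of the sequence to be chosen nonzero.\<close>

lemma beta_K_nonprincipal:
  fixes p :: "'a::group_add filter"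
  assumes "infinite (UNIV :: 'a set)" "p \<in> beta_K"
  shows "\<forall>\<^sub>F y in p. y \<noteq> x"
proof -
  let ?I = "{p :: 'a filter. p \<in> beta \<and> (\<forall>x. \<forall>\<^sub>F y in p. y \<noteq> x)}"
  have "beta_ideal ?I"
    unfolding beta_ideal_def
  proof (intro conjI ballI)
    have "cofinite \<noteq> (bot :: 'a filter)"
      using assms(1) by simp
    then obtain p :: "'a filter" where p: "p \<in> beta" "p \<le> cofinite"
      using ex_beta_le by blast
    have "\<forall>\<^sub>F y in cofinite. y \<noteq> x" for x :: 'a
      by (simp add: eventually_cofinite)
    then show "?I \<noteq> {}"
      using p filter_leD by blast
  next
    fix p q :: "'a filter" assume p: "p \<in> beta" and "q \<in> ?I"
    then have q: "q \<in> beta" "\<And>x. \<forall>\<^sub>F y in q. y \<noteq> x"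
      by auto
    have shift: "s + t \<noteq> x \<longleftrightarrow> t \<noteq> - s + x" for s t x :: 'a
      by (metis add_minus_cancel minus_add_cancel)
    have "\<forall>\<^sub>F z in p +\<^sub>\<beta> q. z \<noteq> x" for x
      using q(2) by (simp add: eventually_beta_add shift)
    then show "p +\<^sub>\<beta> q \<in> ?I"
      using p q beta_add_closed by blast
    have "\<forall>\<^sub>F z in q +\<^sub>\<beta> p. z \<noteq> x" for x
    \<comment> \<open>If \<open>p\<close> is the point \<open>c\<close>, then \<open>q\<close> must
      avoid \<open>x - c\<close>; otherwise the inner filter \<open>p\<close> already avoids
      \<open>- s + x\<close> for every \<open>s\<close>.\<close>
    proof (cases "\<exists>c. \<forall>\<^sub>F t in p. t = c")
      case True
      then obtain c where c: "\<forall>\<^sub>F t in p. t = c" ..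
      have "\<forall>\<^sub>F s in q. s \<noteq> x - c"
        by (rule q(2))
      then have "\<forall>\<^sub>F s in q. \<forall>\<^sub>F t in p. s + t \<noteq> x"
      proof eventually_elim
        case (elim s)
        from c show ?case
          by eventually_elim (use elim in auto)
      qed
      then show ?thesis
        by (simp add: eventually_beta_add)
    next
      case False
      then have "\<forall>\<^sub>F t in p. t \<noteq> c" for c
        using beta_not_eventually[OF p, of "\<lambda>t. t = c"] by blast
      then show ?thesis
        by (simp add: eventually_beta_add shift)
    qed
    then show "q +\<^sub>\<beta> p \<in> ?I"
      using p q beta_add_closed by blast
  qed auto
  then show ?thesis
    using assms(2) beta_K_subset_ideal by blast
qed

text \<open>The finite set \<open>G\<close> of representatives expresses that the image of \<open>h\<close> has finite index.\<close>

lemma filtermap_beta_K: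
  fixes h :: "'a::group_add \<Rightarrow> 'b::group_add"
  assumes add: "\<And>x y. h (x + y) = h x + h y"
    and "finite G" and cosets: "\<And>x. \<exists>g\<in>G. \<exists>y. x = g + h y"
    and p: "p \<in> beta_K"
  shows "filtermap h p \<in> beta_K"
  unfolding beta_K_def
proof (rule InterI, clarify)
  fix I :: "'b filter set" assume I: "beta_ideal I"
  let ?J = "{q \<in> beta. filtermap h q \<in> I}"
  have "beta_ideal ?J"
    unfolding beta_ideal_def
  proof (intro conjI ballI)
    obtain r where r: "r \<in> I" "r \<in> beta"
      using I unfolding beta_ideal_def by blast
    \<comment> \<open>Finite index is what makes \<open>?J\<close> nonempty: some coset of
      \<open>range h\<close> belongs to \<open>r\<close>, and translation by \<open>- g\<close>,
      which stays in \<open>I\<close>, moves it onto \<open>range h\<close>.\<close>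
    have "\<forall>\<^sub>F x in r. \<exists>g\<in>G. x \<in> (+) g ` range h"
      by (intro always_eventually) (use cosets in blast)
    then obtain g where g: "\<forall>\<^sub>F x in r. x \<in> (+) g ` range h"
      using beta_finite_partition[OF r(2) \<open>finite G\<close>, of "\<lambda>g x. x \<in> (+) g ` range h"] by blast
    let ?r = "principal {- g} +\<^sub>\<beta> r"
    have rI: "?r \<in> I"
      using beta_ideal_add(1)[OF I principal_singleton_beta r(1)] .
    then have r': "?r \<in> beta"
      using beta_ideal_subset[OF I] by blast
    have "\<forall>\<^sub>F x in r. - g + x \<in> range h"
      using g by eventually_elim (auto simp flip: add.assoc)
    then have range: "\<forall>\<^sub>F x in ?r. x \<in> range h"
      by (simp add: eventually_beta_add eventually_principal)
    \<comment> \<open>As \<open>range h\<close> belongs to \<open>?r\<close>, the pullback is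
      proper; an ultrafilter refining it maps exactly onto \<open>?r\<close>.\<close>
    have "filtercomap h ?r \<noteq> bot"
    proof
      assume "filtercomap h ?r = bot"
      then obtain Q where "eventually Q ?r" "\<And>x. \<not> Q (h x)"
        by (auto simp: trivial_limit_def eventually_filtercomap)
      with range have "\<forall>\<^sub>F x in ?r. False"
        by (auto elim: eventually_elim2)
      then show False
        using beta_not_bot[OF r'] by (simp add: trivial_limit_def)
    qed
    then obtain q where q: "q \<in> beta" "q \<le> filtercomap h ?r"
      using ex_beta_le by blast
    then have "filtermap h q = ?r"
      by (intro beta_minimal r')
        (simp_all add: filtermap_le_iff_le_filtercomap filtermap_bot_iff beta_not_bot)
    then show "?J \<noteq> {}"
      using q(1) rI by auto
  next
    fix q r :: "'a filter" assume "q \<in> beta" "r \<in> ?J"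
    then show "q +\<^sub>\<beta> r \<in> ?J" "r +\<^sub>\<beta> q \<in> ?J"
      using beta_ideal_add[OF I, of "filtermap h q" "filtermap h r"]
      by (simp_all add: filtermap_beta_add[OF add] filtermap_beta beta_add_closed)
  qed auto
  then show "filtermap h p \<in> I"
    using p beta_K_subset_ideal by blast
qed


section \<open>Lipschitz quaternions\<close>

definition lipschitz_cnj :: "lipschitz \<Rightarrow> lipschitz" where
  "lipschitz_cnj x = Lipschitz (coeff1 x) (- coeffi x) (- coeffj x) (- coeffk x)"

definition lipschitz_norm :: "lipschitz \<Rightarrow> int" where
  "lipschitz_norm x = (coeff1 x)\<^sup>2 + (coeffi x)\<^sup>2 + (coeffj x)\<^sup>2 + (coeffk x)\<^sup>2"

definition lipschitz_of_int :: "int \<Rightarrow> lipschitz" where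
  "lipschitz_of_int n = Lipschitz n 0 0 0"

text \<open>Euler's four-square identity. It rules out zero divisors, so products of nonzero terms
  can serve as the multipliers \<open>a\<close> and \<open>b\<close>.\<close>

lemma lipschitz_norm_mult: "lipschitz_norm (x * y) = lipschitz_norm x * lipschitz_norm y"
  by (simp add: lipschitz_norm_def times_lipschitz_def) algebra

lemma lipschitz_norm_nonneg: "lipschitz_norm x \<ge> 0"
  by (simp add: lipschitz_norm_def)

lemma lipschitz_norm_eq_0_iff: "lipschitz_norm x = 0 \<longleftrightarrow> x = 0"
  by (cases x) (auto simp: lipschitz_norm_def zero_lipschitz_def add_nonneg_eq_0_iff)

instance lipschitz :: ring_1_no_zero_divisors
  by standard (metis lipschitz_norm_eq_0_iff lipschitz_norm_mult mult_eq_0_iff)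

lemma mult_lipschitz_cnj: "x * lipschitz_cnj x = lipschitz_of_int (lipschitz_norm x)"
  by (simp add: lipschitz_norm_def times_lipschitz_def lipschitz_cnj_def lipschitz_of_int_def
      power2_eq_square)

lemma lipschitz_cnj_mult: "lipschitz_cnj x * x = lipschitz_of_int (lipschitz_norm x)"
  by (simp add: lipschitz_norm_def times_lipschitz_def lipschitz_cnj_def lipschitz_of_int_def
      power2_eq_square)

text \<open>The equal right-hand sides show that integers are central.\<close>

lemma lipschitz_of_int_mult:
  "lipschitz_of_int n * x = Lipschitz (n * coeff1 x) (n * coeffi x) (n * coeffj x) (n * coeffk x)"
  "x * lipschitz_of_int n = Lipschitz (n * coeff1 x) (n * coeffi x) (n * coeffj x) (n * coeffk x)"
  by (simp_all add: times_lipschitz_def lipschitz_of_int_def)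

text \<open>Multiplying by conjugates on the inside turns \<open>a * y * b\<close> into
  \<open>?n\<close> times an arbitrary quaternion. So the image contains all multiples of
  \<open>?n\<close>, and reducing coefficients modulo \<open>?n\<close> leaves finitely many
  cosets.\<close>

lemma lipschitz_finite_index:
  fixes a b :: lipschitz
  assumes "a \<noteq> 0" "b \<noteq> 0"
  shows "\<exists>G. finite G \<and> (\<forall>x. \<exists>g\<in>G. \<exists>y. x = g + a * y * b)"
proof -
  let ?n = "lipschitz_norm a * lipschitz_norm b"
  let ?G = "(\<lambda>(c, d, e, f). Lipschitz c d e f) ` ({0..<?n} \<times> {0..<?n} \<times> {0..<?n} \<times> {0..<?n})"
  have n: "?n > 0"
    using assms by (metis lipschitz_norm_eq_0_iff lipschitz_norm_nonneg mult_pos_pos order_le_less)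
  have "\<exists>g\<in>?G. \<exists>y. x = g + a * y * b" for x
  proof -
    let ?r = "Lipschitz (coeff1 x mod ?n) (coeffi x mod ?n) (coeffj x mod ?n) (coeffk x mod ?n)"
    let ?q = "Lipschitz (coeff1 x div ?n) (coeffi x div ?n) (coeffj x div ?n) (coeffk x div ?n)"
    have "a * (lipschitz_cnj a * ?q * lipschitz_cnj b) * b
        = (a * lipschitz_cnj a) * ?q * (lipschitz_cnj b * b)"
      by (simp add: mult.assoc)
    also have "\<dots> = lipschitz_of_int ?n * ?q"
      by (simp add: mult_lipschitz_cnj lipschitz_cnj_mult lipschitz_of_int_mult mult_ac)
    finally have "x = ?r + a * (lipschitz_cnj a * ?q * lipschitz_cnj b) * b"
      by (simp add: lipschitz_of_int_mult plus_lipschitz_def)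
    moreover have "?r \<in> ?G"
      using n by (auto intro!: image_eqI[where
            x = "(coeff1 x mod ?n, coeffi x mod ?n, coeffj x mod ?n, coeffk x mod ?n)"])
    ultimately show ?thesis
      by blast
  qed
  then show ?thesis
    by (intro exI[of _ ?G]) auto
qed

lemma infinite_UNIV_lipschitz: "infinite (UNIV :: lipschitz set)"
proof -
  have "inj lipschitz_of_int"
    by (auto simp: inj_def lipschitz_of_int_def)
  then show ?thesis
    using infinite_UNIV_int finite_imageD finite_subset subset_UNIV by metis
qed

lemma central_star_lipschitz_mult:
  fixes a b :: lipschitz
  assumes "central_star A" "p \<in> beta_K" "p +\<^sub>\<beta> p = p" "a \<noteq> 0" "b \<noteq> 0"
  shows "\<forall>\<^sub>F x in p. a * x * b \<in> A"
proof -
  let ?h = "\<lambda>x. a * x * b"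
  have add: "?h (x + y) = ?h x + ?h y" for x y
    by (simp add: algebra_simps)
  obtain G where "finite G" "\<And>x. \<exists>g\<in>G. \<exists>y. x = g + a * y * b"
    using lipschitz_finite_index[OF assms(4,5)] by blast
  then have "filtermap ?h p \<in> beta_K"
    using filtermap_beta_K[of ?h G p] add assms(2) by blast
  moreover have "filtermap ?h p +\<^sub>\<beta> filtermap ?h p = filtermap ?h p"
    using filtermap_beta_add[of ?h p p] add assms(3) by simp
  ultimately have "\<forall>\<^sub>F x in filtermap ?h p. x \<in> A"
    using assms(1) by (simp add: central_star_def)
  then show ?thesis
    by (simp add: eventually_filtermap)
qed


section \<open>Finite sums and products\<close>

text \<open>The ultrafilters below this filter are exactly those in all closures of the sets
  \<open>FS y m\<close> with \<open>m \<ge> 1\<close>.\<close>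

definition FS_filter :: "(nat \<Rightarrow> 'a::comm_monoid_add) \<Rightarrow> 'a filter" where
  "FS_filter y = (INF m\<in>{1..}. principal (FS y m))"

lemma FS_antimono: "m \<le> n \<Longrightarrow> FS y n \<subseteq> FS y m"
  unfolding FS_def by fastforce

lemma eventually_FS_filter: "eventually P (FS_filter y) \<longleftrightarrow> (\<exists>m\<ge>1. \<forall>x\<in>FS y m. P x)"
  unfolding FS_filter_def
proof (subst eventually_INF_base)
  fix m n :: nat assume "m \<in> {1..}" "n \<in> {1..}"
  then show "\<exists>k\<in>{1..}. principal (FS y k) \<le> inf (principal (FS y m)) (principal (FS y n))"
    by (intro bexI[of _ "max m n"]) (auto simp: FS_antimono)
qed (auto simp: eventually_principal)

text \<open>Once \<open>x\<close> is a sum over \<open>F\<close>, a sum over indices beyond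
  \<open>Max F\<close> has a disjoint index set, so adding it to \<open>x\<close> gives another
  finite sum.\<close>

lemma FS_filter_add: "FS_filter y +\<^sub>\<beta> FS_filter y \<le> FS_filter y"
proof (rule filter_leI)
  fix P assume "eventually P (FS_filter y)"
  then obtain m where m: "m \<ge> 1" "\<And>x. x \<in> FS y m \<Longrightarrow> P x"
    unfolding eventually_FS_filter by blast
  have "\<forall>\<^sub>F z in FS_filter y. P (x + z)" if x: "x \<in> FS y m" for x
  proof -
    obtain F where F: "x = (\<Sum>n\<in>F. y n)" "finite F" "F \<noteq> {}" "F \<subseteq> {m..}"
      using x unfolding FS_def by auto
    have "x + z \<in> FS y m" if z: "z \<in> FS y (Suc (Max F))" for z
    proof -
      obtain H where H: "z = (\<Sum>n\<in>H. y n)" "finite H" "H \<subseteq> {Suc (Max F)..}"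
        using z unfolding FS_def by auto
      have lt: "i < j" if "i \<in> F" "j \<in> H" for i j
        using that F(2) H(3) Max_ge[OF F(2)] by (meson atLeast_iff le_imp_less_Suc order_less_le_trans subsetD)
      then have "F \<inter> H = {}"
        by fastforce
      then have "x + z = (\<Sum>n\<in>F \<union> H. y n)"
        using F H by (simp add: sum.union_disjoint)
      moreover have "F \<union> H \<subseteq> {m..}"
        using F(3,4) lt by fastforce
      ultimately show ?thesis
        unfolding FS_def using F(2,3) H(2) by blast
    qed
    then show ?thesis
      unfolding eventually_FS_filter using m(2) by (intro exI[of _ "Suc (Max F)"]) auto
  qed
  then show "eventually P (FS_filter y +\<^sub>\<beta> FS_filter y)"
    unfolding eventually_beta_add eventually_FS_filter[of _ y] using m(1) by blast
qed

text \<open>The recursive construction, in which the central-star property enters only through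
  \<open>mult\<close>; the case \<open>a = b = 1\<close> puts \<open>A\<close> itself in
  \<open>p\<close>.\<close>

lemma FS_AP_sum_subsystem:
  fixes y :: "nat \<Rightarrow> 'a::ring_1_no_zero_divisors"
  assumes p: "p \<in> beta" "p +\<^sub>\<beta> p = p" "p \<le> FS_filter y"
    and nz: "\<forall>\<^sub>F x in p. x \<noteq> 0"
    and mult: "\<And>a b. a \<noteq> 0 \<Longrightarrow> b \<noteq> 0 \<Longrightarrow> \<forall>\<^sub>F x in p. a * x * b \<in> A"
  shows "\<exists>x. sum_subsystem x y \<and> FS x 1 \<union> AP x \<subseteq> A"
proof -
  \<comment> \<open>Galvin's device: by idempotence \<open>B\<close> is in \<open>p\<close>, and for
    \<open>s\<close> in \<open>B\<close> the translate of \<open>B\<close> by \<open>- s\<close> is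
    again in \<open>p\<close>. Keeping partial sums in \<open>B\<close> rather than \<open>A\<close>
    lets the recursion continue.\<close>
  define B where "B = {x \<in> A. \<forall>\<^sub>F z in p. x + z \<in> A}"
  have idem: "eventually P p \<longleftrightarrow> (\<forall>\<^sub>F x in p. \<forall>\<^sub>F z in p. P (x + z))" for P
    using eventually_beta_add[of P p p] p(2) by simp
  have "\<forall>\<^sub>F x in p. x \<in> A"
    using mult[of 1 1] by simp
  then have B: "\<forall>\<^sub>F x in p. x \<in> B"
    using idem[of "\<lambda>x. x \<in> A"] by (simp add: B_def eventually_conj_iff)
  have B_add: "\<forall>\<^sub>F x in p. s + x \<in> B" if "s \<in> B" for s
    using that idem[of "\<lambda>x. s + x \<in> A"] by (simp add: B_def eventually_conj_iff add.assoc)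
  define X :: "nat set \<Rightarrow> 'a" where "X = (\<lambda>H. \<Sum>t\<in>H. y t)"
  \<comment> \<open>The empty list is included, so the new term may be the first, the last or the
    only factor.\<close>
  define lists :: "nat \<Rightarrow> nat list set" where "lists = (\<lambda>n. {us. set us \<subseteq> {..<n} \<and> distinct us})"
  text \<open>
    Condition on the \<open>n\<close>-th term \<open>x\<close>: splitting off the largest index, every finite sum and every
    product of distinct terms is covered by the condition at that index.
  \<close>
  define good :: "(nat \<Rightarrow> nat set) \<Rightarrow> nat \<Rightarrow> 'a \<Rightarrow> bool" where
    "good = (\<lambda>f n x. x \<noteq> 0 \<and> (\<forall>F\<in>Pow {..<n}. (\<Sum>k\<in>F. X (f k)) + x \<in> B) \<and>
      (\<forall>us\<in>lists n. \<forall>vs\<in>lists n. prod_list (map (X \<circ> f) us) * x * prod_list (map (X \<circ> f) vs) \<in> A))"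
  define step where "step = (\<lambda>f n H. finite H \<and> H \<noteq> {} \<and> H \<subseteq> {1..} \<and>
      (\<forall>k<n. \<forall>i\<in>f k. \<forall>j\<in>H. i < j) \<and> good f n (X H))"
  have fin_lists: "finite (lists n)" for n
    by (simp add: lists_def finite_subset_distinct)
  have sum_B: "(\<Sum>k\<in>F. X (f k)) \<in> B"
    if "finite F" "F \<noteq> {}" "\<And>k. k \<in> F \<Longrightarrow> step f k (f k)" for f F
  proof -
    have "F - {Max F} \<in> Pow {..<Max F}"
      using that by (auto simp: order_less_le)
    then have "(\<Sum>k\<in>F - {Max F}. X (f k)) + X (f (Max F)) \<in> B"
      using that(3)[OF Max_in[OF that(1,2)]] unfolding step_def good_def by blast
    then show ?thesis
      using sum.remove[OF that(1) Max_in[OF that(1,2)]] by (metis add.commute)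
  qed
  have "\<exists>f. \<forall>n. step f n (f n)"
  \<comment> \<open>Course-of-values recursion: the first goal says that \<open>step\<close> at
    \<open>n\<close> depends only on blocks before \<open>n\<close>, the second that a next block
    exists.\<close>
  proof (rule dependent_wf_choice[of less_than])
    fix f g :: "nat \<Rightarrow> nat set" and n H
    assume "\<And>k. (k, n) \<in> less_than \<Longrightarrow> f k = g k"
    then have eq: "f k = g k" if "k < n" for k
      using that by simp
    have sum_eq: "(\<Sum>k\<in>F. X (f k)) = (\<Sum>k\<in>F. X (g k))" if "F \<in> Pow {..<n}" for F
      using that eq by (intro sum.cong) auto
    have map_eq: "map (X \<circ> f) us = map (X \<circ> g) us" if "us \<in> lists n" for us
      using that eq by (auto simp: lists_def)
    have "good f n (X H) = good g n (X H)"
      unfolding good_def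
      by (intro arg_cong2[where f = "(\<and>)"] ball_cong refl) (simp_all only: sum_eq map_eq)
    then show "step f n H = step g n H"
      unfolding step_def by (auto simp: eq)
  next
    fix n and f :: "nat \<Rightarrow> nat set"
    assume "\<And>k. (k, n) \<in> less_than \<Longrightarrow> step f k (f k)"
    then have f: "step f k (f k)" if "k < n" for k
      using that by simp
    have X_nz: "X (f k) \<noteq> 0" if "k < n" for k
      using f[OF that] unfolding step_def good_def by blast
    have prod_nz: "prod_list (map (X \<circ> f) us) \<noteq> 0" if "us \<in> lists n" for us
      using that X_nz by (force simp: lists_def prod_list_zero_iff)
    have "\<forall>\<^sub>F x in p. (\<Sum>k\<in>F. X (f k)) + x \<in> B" if "F \<in> Pow {..<n}" for F
    \<comment> \<open>The empty sum 0 need not lie in \<open>B\<close>, so this case uses directly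
      that \<open>B\<close> is in \<open>p\<close>.\<close>
    proof (cases "F = {}")
      case False
      then show ?thesis
        using that f by (intro B_add sum_B) (auto intro: finite_subset)
    qed (simp add: B)
    then have "\<forall>\<^sub>F x in p. good f n x"
      unfolding good_def
      by (intro eventually_conj nz eventually_ball_finite ballI fin_lists mult prod_nz) auto
    moreover
    \<comment> \<open>One past every index used so far. The inserted 0 gives \<open>Max\<close> a
      nonempty set when \<open>n = 0\<close>, and \<open>Suc\<close> ensures
      \<open>m \<ge> 1\<close>, so blocks avoid index 0.\<close>
    define m where "m = Suc (Max (insert 0 (\<Union>k<n. f k)))"
    have "\<forall>\<^sub>F x in p. x \<in> FS y m"
      by (rule filter_leD[OF p(3)]) (auto simp: eventually_FS_filter m_def intro!: exI[of _ m])
    ultimately have "\<forall>\<^sub>F x in p. good f n x \<and> x \<in> FS y m"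
      by (rule eventually_conj)
    then obtain x where x: "good f n x" "x \<in> FS y m"
      using eventually_happens'[OF beta_not_bot[OF p(1)]] by blast
    then obtain H where H: "x = X H" "finite H" "H \<noteq> {}" "H \<subseteq> {m..}"
      unfolding FS_def X_def by blast
    have "finite (insert 0 (\<Union>k<n. f k))"
      using f by (auto simp: step_def)
    then have "i < m" if "i \<in> f k" "k < n" for i k
      using that unfolding m_def by (intro le_imp_less_Suc Max_ge) auto
    then have "step f n H"
      using H x(1) unfolding step_def by (fastforce simp: m_def)
    then show "\<exists>H. step f n H" ..
  qed simp
  then obtain f where f: "\<And>n. step f n (f n)"
    by blast
  have lt: "i < j" if "k < n" "i \<in> f k" "j \<in> f n" for i j k n
    using f[of n] that unfolding step_def by blast
  have H: "finite (f n)" "f n \<noteq> {}" "f n \<subseteq> {1..}" for n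
    using f[of n] unfolding step_def by blast+
  have "Max (f n) < Min (f (Suc n))" for n
    by (rule lt[of n "Suc n"]) (simp_all add: H)
  then have "sum_subsystem (X \<circ> f) y"
    unfolding sum_subsystem_def by (intro exI[of _ f]) (simp add: H X_def del: One_nat_def)
  moreover have "FS (X \<circ> f) 1 \<subseteq> A"
  proof
    fix z assume "z \<in> FS (X \<circ> f) 1"
    then obtain F where "z = (\<Sum>k\<in>F. X (f k))" "finite F" "F \<noteq> {}"
      unfolding FS_def by auto
    then have "z \<in> B"
      using sum_B f by blast
    then show "z \<in> A"
      by (simp add: B_def)
  qed
  moreover have "AP (X \<circ> f) \<subseteq> A"
  proof
    fix z assume "z \<in> AP (X \<circ> f)"
    then obtain ns where ns: "z = prod_list (map (X \<circ> f) ns)" "ns \<noteq> []" "distinct ns"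
      unfolding AP_def by blast
    define m where "m = Max (set ns)"
    have "m \<in> set ns"
      using ns(2) by (simp add: m_def)
    \<comment> \<open>The factors on either side of the largest index have smaller indices because
      \<open>ns\<close> is distinct; the middle-factor condition of \<open>good\<close> at
      \<open>m\<close> then applies.\<close>
    then obtain us vs where split: "ns = us @ m # vs"
      by (auto simp: in_set_conv_decomp)
    have "set ns \<subseteq> {..m}"
      by (auto simp: m_def)
    then have "us \<in> lists m" "vs \<in> lists m"
      using ns(3) split by (auto simp: lists_def order_less_le)
    then have "prod_list (map (X \<circ> f) us) * X (f m) * prod_list (map (X \<circ> f) vs) \<in> A"
      using f[of m] unfolding step_def good_def by blast
    then show "z \<in> A"
      using ns(1) split by (simp add: mult.assoc)
  qed
  ultimately show ?thesis
    by blast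
qed

theorem theorem3p5:
  fixes A :: "lipschitz set" and y :: "nat \<Rightarrow> lipschitz"
  assumes "central_star A" and "minimal_seq y"
  shows "\<exists>x. sum_subsystem x y \<and> FS x 1 \<union> AP x \<subseteq> A"
proof -
  obtain q where q: "q \<in> beta_K" "\<And>m. m \<ge> 1 \<Longrightarrow> \<forall>\<^sub>F x in q. x \<in> FS y m"
    using assms(2) by (auto simp: minimal_seq_def beta_closure_def)
  then have "q \<le> FS_filter y"
    by (auto simp: FS_filter_def le_INF_iff le_principal)
  then obtain p where p: "p \<in> beta_K" "p \<le> FS_filter y" "p +\<^sub>\<beta> p = p"
    using ex_idempotent_beta_K FS_filter_add q(1) by blast
  show ?thesis
  proof (rule FS_AP_sum_subsystem)
    show "p \<in> beta"
      using p(1) beta_K_subset_beta by blast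
    show "\<forall>\<^sub>F x in p. x \<noteq> 0"
      using beta_K_nonprincipal infinite_UNIV_lipschitz p(1) by blast
  qed (use p central_star_lipschitz_mult[OF assms(1)] in auto)
qed

end
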